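(* Let $n \geq 1$ be an integer. Then there exists a positive divisor $d$ of $n$ with $d \leq n^{1/4}$ such that $\tau(n) \leq 8\, \tau(d)^7$.
   Context: $\tau(n)$ denotes the number of positive divisors of the positive integer $n$. *)

theory Defs
  imports Complex_Main
begin

(* For n = 0 the set of divisors is infinite, so divisor_tau 0 = 0 by the convention on card. *)
definition divisor_tau :: "nat \<Rightarrow> nat" where
  "divisor_tau n = card {d. d dvd n}"

end

theory Submission
  imports Defs "HOL-Computational_Algebra.Primes"
begin

(* Split n into coprime parts m and r such that m has a divisor d with d^4 <= m and
   tau m <= tau d ^ 7, and r has at most three prime factors counted with multiplicity,
   so that tau r <= 8.  The prime powers p^a of n are absorbed one at a time: if a >= 4, then
   p^a goes to m and contributes p^(a div 4) to d; otherwise p^a goes to r.  Once r has four or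
   more prime factors, tau r is at most 8 * 4 = 32 <= 2^7, and all of r moves to m, its least
   prime (which is at most r^(1/4)) moving to d. *)

section \<open>The divisor function on prime powers and on products\<close>

lemma divisor_tau_Suc_0 [simp]: "divisor_tau (Suc 0) = 1"
  by (simp add: divisor_tau_def)

lemma divisor_tau_prime_power:
  assumes "prime p"
  shows "divisor_tau (p ^ k) = Suc k"
proof -
  have "{d. d dvd p ^ k} = (\<lambda>i. p ^ i) ` {..k}"
    using divides_primepow_nat[OF assms] by auto
  moreover have "inj_on (\<lambda>i. p ^ i) {..k}"
    using prime_gt_1_nat[OF assms] by (auto intro: inj_onI)
  ultimately show ?thesis
    by (simp add: divisor_tau_def card_image)
qed

text \<open>Every divisor of \<open>a * b\<close> splits as a divisor of \<open>a\<close> times a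
  divisor of \<open>b\<close>, so multiplication maps the pairs of divisors onto a set containing
  all divisors of the product.\<close>

lemma divisor_tau_mult_le:
  assumes "a > 0" "b > 0"
  shows "divisor_tau (a * b) \<le> divisor_tau a * divisor_tau b"
proof -
  let ?S = "{d. d dvd a} \<times> {d. d dvd b}"
  have "{d. d dvd a * b} \<subseteq> (\<lambda>(x, y). x * y) ` ?S"
    by (auto dest!: division_decomp)
  then have "card {d. d dvd a * b} \<le> card ?S"
    using assms by (intro surj_card_le) (auto simp: finite_divisors_nat)
  then show ?thesis
    by (simp add: divisor_tau_def card_cartesian_product)
qed

lemma divisor_tau_mult_coprime:
  assumes "a > 0" "b > 0" and cop: "coprime a b"
  shows "divisor_tau (a * b) = divisor_tau a * divisor_tau b"
proof (rule antisym)
  show "divisor_tau (a * b) \<le> divisor_tau a * divisor_tau b"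
    using assms by (intro divisor_tau_mult_le)
  let ?S = "{d. d dvd a} \<times> {d. d dvd b}"
  \<comment> \<open>Coprimality lets each factor pass over the foreign one: \<open>x\<close> divides
    \<open>x' * y'\<close> and is coprime to \<open>y'\<close>. Swapping the two pairs gives the
    reverse divisibilities, hence injectivity of the product map.\<close>
  have dvd_left: "x dvd x'" and dvd_right: "y dvd y'"
    if "x dvd a" "y dvd b" "x' dvd a" "y' dvd b" "x * y = x' * y'" for x y x' y'
  proof -
    have "coprime x y'" "coprime y x'"
      using coprime_divisors[OF that(1,4) cop] coprime_divisors[OF that(3,2) cop]
      by (simp_all only: coprime_commute)
    moreover have "x dvd x' * y'" "y dvd x' * y'"
      using that(5) by (metis dvd_triv_left, metis dvd_triv_right)
    ultimately show "x dvd x'" "y dvd y'"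
      by (simp_all only: coprime_dvd_mult_left_iff coprime_dvd_mult_right_iff)
  qed
  have "inj_on (\<lambda>(x, y). x * y) ?S"
  proof (rule inj_onI, clarify)
    fix x y x' y'
    assume "x dvd a" "y dvd b" "x' dvd a" "y' dvd b" "x * y = x' * y'"
    then show "x = x' \<and> y = y'"
      using dvd_left[of x y x' y'] dvd_right[of x y x' y']
        dvd_left[of x' y' x y] dvd_right[of x' y' x y] by (simp only: dvd_antisym)
  qed
  moreover have "(\<lambda>(x, y). x * y) ` ?S \<subseteq> {d. d dvd a * b}"
    by (auto intro: mult_dvd_mono)
  ultimately have "card ?S \<le> card {d. d dvd a * b}"
    using assms by (intro card_inj_on_le) (auto simp: finite_divisors_nat)
  then show "divisor_tau a * divisor_tau b \<le> divisor_tau (a * b)"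
    by (simp add: divisor_tau_def card_cartesian_product)
qed

section \<open>Bounds by the number of prime factors counted with multiplicity\<close>

text \<open>By submultiplicativity, each further prime factor at most doubles the number of
  divisors.\<close>

lemma divisor_tau_le_power_bigomega:
  fixes n :: nat
  assumes "n > 0"
  shows "divisor_tau n \<le> 2 ^ size (prime_factorization n)"
  using assms
proof (induction n rule: prime_divisors_induct)
  case (factor p n)
  then have "p > 0" "n > 0"
    by (auto simp: prime_gt_0_nat)
  then have "divisor_tau (p * n) \<le> divisor_tau p * divisor_tau n"
    by (rule divisor_tau_mult_le)
  also have "divisor_tau p = 2"
    using divisor_tau_prime_power[OF factor.hyps(1), of 1] by simp
  also have "2 * divisor_tau n \<le> 2 ^ size (prime_factorization (p * n))"
    using factor \<open>n > 0\<close> \<open>p > 0\<close>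
    by (simp add: prime_factorization_mult prime_factorization_prime)
  finally show ?case .
next
  case (unit n)
  then show ?case by (simp add: divisor_tau_def)
qed simp

lemma power_bigomega_le:
  fixes n :: nat
  assumes "n > 0" and le: "\<And>q. prime q \<Longrightarrow> q dvd n \<Longrightarrow> p \<le> q"
  shows "p ^ size (prime_factorization n) \<le> n"
  using assms
proof (induction n rule: prime_divisors_induct)
  case (factor q n)
  then have "q > 0" "n > 0"
    by (auto simp: prime_gt_0_nat)
  have "p ^ size (prime_factorization (q * n)) = p * p ^ size (prime_factorization n)"
    using factor.hyps \<open>n > 0\<close> \<open>q > 0\<close>
    by (simp add: prime_factorization_mult prime_factorization_prime)
  also have "\<dots> \<le> q * n"
    using factor \<open>n > 0\<close> by (intro mult_mono) auto
  finally show ?case .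
qed auto

text \<open>The least prime divisor works, since every prime factor of \<open>n\<close> is at least
  as large.\<close>

lemma ex_prime_divisor_power_bigomega_le:
  fixes n :: nat
  assumes "n > 1"
  obtains p where "prime p" "p dvd n" "p ^ size (prime_factorization n) \<le> n"
proof -
  define p where "p = (LEAST q. prime q \<and> q dvd n)"
  have "\<exists>q. prime q \<and> q dvd n"
    using assms prime_factor_nat[of n] by auto
  then have "prime p \<and> p dvd n"
    unfolding p_def by (rule LeastI_ex)
  moreover have "p ^ size (prime_factorization n) \<le> n"
    using assms by (intro power_bigomega_le) (auto simp: p_def intro: Least_le)
  ultimately show ?thesis
    using that by blast
qed

section \<open>Divisors below the fourth root that have many divisors\<close>

text \<open>This compares the divisor counts of \<open>p ^ a\<close> and
  \<open>p ^ (a div 4)\<close>. With q = \<open>Suc (a div 4)\<close>, division with remainder gives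
  a + 1 \<le> 4q, and a \<ge> 4 gives q \<ge> 2, so the factor 4 is absorbed by q^2.\<close>

lemma Suc_le_Suc_div_4_power:
  fixes a :: nat
  assumes "a \<ge> 4"
  shows "Suc a \<le> Suc (a div 4) ^ 7"
proof -
  let ?q = "Suc (a div 4)"
  have "2 \<le> ?q"
    using assms by linarith
  then have "2 ^ 2 \<le> ?q ^ 2"
    by (rule power_mono) simp
  have "Suc a \<le> 2 ^ 2 * ?q"
    by simp
  also have "\<dots> \<le> ?q ^ 2 * ?q"
    using \<open>2 ^ 2 \<le> ?q ^ 2\<close> by (rule mult_right_mono) simp
  also have "\<dots> = ?q ^ 3"
    by (simp add: power2_eq_square power3_eq_cube)
  also have "\<dots> \<le> ?q ^ 7"
    by (rule power_increasing) auto
  finally show ?thesis .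
qed

text \<open>The inequality \<open>d ^ 4 \<le> m\<close> expresses d \<le> m^(1/4) within the
  naturals, in a form that multiplies directly.\<close>

definition small_rich_divisor :: "nat \<Rightarrow> nat \<Rightarrow> bool" where
  "small_rich_divisor d m \<longleftrightarrow>
     d dvd m \<and> d ^ 4 \<le> m \<and> divisor_tau m \<le> divisor_tau d ^ 7"

text \<open>The conditions multiply. Coprimality passes to \<open>d\<close> and \<open>e\<close>,
  where tau must be exactly multiplicative; for \<open>m * c\<close> submultiplicativity
  suffices.\<close>

lemma small_rich_divisor_mult:
  assumes "m > 0" "c > 0" "coprime m c"
    and "small_rich_divisor d m" "small_rich_divisor e c"
  shows "small_rich_divisor (d * e) (m * c)"
proof -
  have d: "d dvd m" "d ^ 4 \<le> m" "divisor_tau m \<le> divisor_tau d ^ 7"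
    and e: "e dvd c" "e ^ 4 \<le> c" "divisor_tau c \<le> divisor_tau e ^ 7"
    using assms by (auto simp: small_rich_divisor_def)
  have "d > 0" "e > 0"
    using d(1) e(1) assms(1,2) by (auto intro: Nat.gr0I)
  moreover have "coprime d e"
    using assms(3) d(1) e(1) by (auto intro: coprime_divisors)
  ultimately have "divisor_tau (d * e) ^ 7 = divisor_tau d ^ 7 * divisor_tau e ^ 7"
    by (simp add: divisor_tau_mult_coprime power_mult_distrib)
  then have "divisor_tau (m * c) \<le> divisor_tau (d * e) ^ 7"
    using divisor_tau_mult_le[OF assms(1,2)] mult_mono[OF d(3) e(3)] by simp
  then show ?thesis
    using d e by (simp add: small_rich_divisor_def mult_dvd_mono power_mult_distrib mult_mono)
qed

lemma small_rich_divisor_prime_power: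
  assumes "prime p" "a \<ge> 4"
  shows "small_rich_divisor (p ^ (a div 4)) (p ^ a)"
proof -
  have "(p ^ (a div 4)) ^ 4 \<le> p ^ a"
    unfolding power_mult[symmetric]
    using prime_gt_0_nat[OF assms(1)] by (intro power_increasing) auto
  then show ?thesis
    using assms Suc_le_Suc_div_4_power[of a]
    by (simp add: small_rich_divisor_def divisor_tau_prime_power le_imp_power_dvd)
qed

text \<open>The least prime p of \<open>c\<close> is the witness: four or more prime factors give
  p^4 \<le> c, and tau(p) = 2 turns the required bound into the assumed
  \<open>2 ^ 7\<close>.\<close>

lemma ex_small_rich_divisor_bigomega:
  fixes c :: nat
  assumes "c > 0" "size (prime_factorization c) \<ge> 4" "divisor_tau c \<le> 2 ^ 7"
  shows "\<exists>e. small_rich_divisor e c"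
proof -
  have "c > 1"
    using assms by (cases "c = 1") auto
  then obtain p where p: "prime p" "p dvd c" "p ^ size (prime_factorization c) \<le> c"
    by (rule ex_prime_divisor_power_bigomega_le)
  have "p ^ 4 \<le> p ^ size (prime_factorization c)"
    using assms(2) prime_gt_0_nat[OF p(1)] by (intro power_increasing) auto
  moreover have "divisor_tau p = 2"
    using divisor_tau_prime_power[OF p(1), of 1] by simp
  ultimately show ?thesis
    using p assms(3)
    by (auto simp: small_rich_divisor_def intro!: exI[of _ p])
qed

section \<open>The decomposition by strong induction\<close>

text \<open>Coprimality of \<open>m\<close> and \<open>r\<close> is carried through the induction
  because moving \<open>r\<close> into \<open>m\<close> later multiplies their witnesses.\<close>

lemma small_rich_divisor_decomposition:
  fixes n :: nat
  assumes "n > 0"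
  shows "\<exists>m r d. n = m * r \<and> coprime m r \<and> small_rich_divisor d m \<and>
           size (prime_factorization r) \<le> 3"
  using assms
proof (induction n rule: less_induct)
  case (less n)
  have one: "small_rich_divisor 1 1"
    by (simp add: small_rich_divisor_def)
  show ?case
  proof (cases "n = 1")
    case True
    then show ?thesis
      using one by (intro exI[of _ 1]) simp
  next
    case False
    then obtain p where p: "prime p" "p dvd n"
      \<comment> \<open>The full power of p is stripped from \<open>n\<close>, so that
        \<open>p ^ a\<close> is coprime to both parts of the cofactor.\<close>
      using prime_factor_nat by blast
    obtain n' where n': "n = p ^ multiplicity p n * n'" "\<not> p dvd n'"
      using less.prems p(1) by (metis multiplicity_decompose' not_prime_unit gr_implies_not0)
    define a where "a = multiplicity p n"
    have n_eq: "n = p ^ a * n'"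
      using n'(1) by (simp add: a_def)
    have "a > 0"
      using p less.prems by (simp add: a_def prime_multiplicity_gt_zero_iff)
    have "n' > 0"
      using n'(2) by (auto intro: Nat.gr0I)
    moreover have "p ^ a > 1"
      using \<open>a > 0\<close> prime_gt_1_nat[OF p(1)] by (intro one_less_power)
    ultimately have "n' < n"
      by (simp add: n_eq)
    with less.IH \<open>n' > 0\<close> obtain m r d where
      mr: "n' = m * r" "coprime m r" and d: "small_rich_divisor d m"
      and r: "size (prime_factorization r) \<le> 3"
      by blast
    have pos: "m > 0" "r > 0" "p ^ a > 0"
      using \<open>n' > 0\<close> mr(1) prime_gt_0_nat[OF p(1)] by auto
    have "coprime p n'"
      using p(1) n'(2) by (simp add: prime_imp_coprime)
    then have cop: "coprime (p ^ a) m" "coprime (p ^ a) r"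
      using mr(1) by simp_all
    have size_eq: "size (prime_factorization (r * p ^ a)) = size (prime_factorization r) + a"
      using pos p(1) by (simp add: prime_factorization_mult prime_factorization_prime_power)
    consider "a \<ge> 4" | "size (prime_factorization r) + a \<le> 3"
      | "a \<le> 3" "size (prime_factorization r) + a \<ge> 4"
      by linarith
    then show ?thesis
    proof cases
      case 1
      have "small_rich_divisor (d * p ^ (a div 4)) (m * p ^ a)"
        using pos cop d small_rich_divisor_prime_power[OF p(1) 1]
        by (intro small_rich_divisor_mult) (auto simp: coprime_commute)
      moreover have "n = (m * p ^ a) * r" "coprime (m * p ^ a) r"
        using n_eq mr cop by (simp_all add: mult_ac)
      ultimately show ?thesis
        using r by blast
    next
      case 2
      have "n = m * (r * p ^ a)" "coprime m (r * p ^ a)"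
        using n_eq mr cop by (simp_all add: mult_ac coprime_commute)
      then show ?thesis
        using d 2 size_eq by metis
    next
      case 3
      let ?c = "r * p ^ a"
      have "divisor_tau ?c \<le> divisor_tau r * divisor_tau (p ^ a)"
        using pos by (intro divisor_tau_mult_le)
      \<comment> \<open>Both \<open>r\<close> and \<open>p ^ a\<close> have at most three prime
        factors here, and tau(p^a) = a + 1 \<le> 4. The product 32 is below
        \<open>2 ^ 7\<close>.\<close>
      also have "\<dots> \<le> 2 ^ 3 * 4"
      proof (rule mult_mono)
        have "(2::nat) ^ size (prime_factorization r) \<le> 2 ^ 3"
          using r by (intro power_increasing) auto
        then show "divisor_tau r \<le> 2 ^ 3"
          using divisor_tau_le_power_bigomega[OF pos(2)] by linarith
        show "divisor_tau (p ^ a) \<le> 4"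
          using 3(1) p(1) by (simp add: divisor_tau_prime_power)
      qed auto
      finally obtain e where "small_rich_divisor e ?c"
        using ex_small_rich_divisor_bigomega[of ?c] 3(2) size_eq pos by auto
      then have "small_rich_divisor (d * e) (m * ?c)"
        using pos mr cop d by (intro small_rich_divisor_mult) (auto simp: coprime_commute)
      \<comment> \<open>The remainder is emptied: the new part outside \<open>m * ?c\<close> is
        1.\<close>
      moreover have "n = (m * ?c) * 1"
        using n_eq mr by (simp add: mult_ac)
      ultimately show ?thesis
        by (metis coprime_1_right prime_factorization_1 size_empty zero_le)
    qed
  qed
qed

theorem theorem1p1:
  fixes n :: nat
  assumes "n \<ge> 1"
  shows "\<exists>d::nat. d dvd n \<and> real d \<le> real n powr (1/4) \<and>
           divisor_tau n \<le> 8 * divisor_tau d ^ 7"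
proof -
  obtain m r d where n_eq: "n = m * r" and d: "small_rich_divisor d m"
    and r: "size (prime_factorization r) \<le> 3"
    using small_rich_divisor_decomposition[of n] assms by auto
  have pos: "m > 0" "r > 0"
    using n_eq assms by (auto intro: Nat.gr0I)
  have "d dvd n"
    using d n_eq by (simp add: small_rich_divisor_def)
  moreover have "real d \<le> real n powr (1/4)"
  proof -
    have "d > 0"
      using \<open>d dvd n\<close> assms by (auto intro: Nat.gr0I)
    have "m \<le> n"
      using n_eq pos by simp
    then have "d ^ 4 \<le> n"
      using d by (simp add: small_rich_divisor_def)
    then have "real d ^ 4 \<le> real n"
      by (metis of_nat_le_iff of_nat_power)
    \<comment> \<open>Positivity of \<open>d\<close> allows \<open>real d ^ 4\<close> to be read as
      a \<open>powr\<close>, so that the exponents 4 and 1/4 cancel.\<close>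
    moreover have "real d = (real d ^ 4) powr (1/4)"
      using \<open>d > 0\<close> by (simp add: powr_powr flip: powr_numeral)
    ultimately show ?thesis
      by (metis powr_mono2 of_nat_0_le_iff zero_le_power zero_le_divide_1_iff zero_le_numeral)
  qed
  moreover have "divisor_tau n \<le> 8 * divisor_tau d ^ 7"
  proof -
    \<comment> \<open>The constant 8 = 2^3 pays for the remainder \<open>r\<close>, which
      contributes nothing to \<open>d\<close>.\<close>
    have "(2::nat) ^ size (prime_factorization r) \<le> 2 ^ 3"
      using r by (intro power_increasing) auto
    then have "divisor_tau r \<le> 8"
      using divisor_tau_le_power_bigomega[OF pos(2)] by simp
    then have "divisor_tau m * divisor_tau r \<le> divisor_tau d ^ 7 * 8"
      using d by (intro mult_mono) (auto simp: small_rich_divisor_def)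
    then show ?thesis
      using divisor_tau_mult_le[OF pos] n_eq by (simp add: mult.commute)
  qed
  ultimately show ?thesis
    by blast
qed

end
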